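(* For any sequence $(y_i)_{i\geq 1}$ of real numbers there is a function $\psi:\mathbb{Z}_{\geq 1}\to[0,\infty)$ such that $\sum_{n\geq 1}\psi(n)$ diverges and such that for every $y\in\{y_i : i\geq 1\}$, the set of real numbers $x$ for which the inequality $\|nx+y\|<\psi(n)$ is satisfied by infinitely many integers $n\geq 1$ has Lebesgue measure zero.
   Context: For a real number $t$, $\|t\|$ denotes the distance from $t$ to the nearest integer. *)

theory Defs
  imports "HOL-Analysis.Analysis"
begin

definition dist_nearest_int :: "real \<Rightarrow> real"
  where "dist_nearest_int t = \<bar>t - of_int (round t)\<bar>"

end

theory Submission
  imports Defs
begin

text \<open>
  Let \<open>D\<close> be a finite set of positive integers, \<open>N\<close> a common multiple of \<open>D\<close>, and put
  \<open>\<psi> n = \<epsilon> / d\<close> for \<open>n = N / d\<close>, \<open>d \<in> D\<close>. Multiplying by \<open>d\<close>, the inequality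
  \<open>\<parallel>n x + y\<parallel> < \<psi> n\<close> gives \<open>\<parallel>N x + d y\<parallel> < \<epsilon>\<close>. If \<open>d y\<close> lies within \<open>\<epsilon>\<close> of one point \<open>t\<close> modulo 1
  for all \<open>d \<in> D\<close>, then all these inequalities force \<open>\<parallel>N x + t\<parallel> < 2 \<epsilon>\<close>, a condition of
  density \<open>4 \<epsilon>\<close>, whereas the sum of \<open>\<psi>\<close> over the block is \<open>\<epsilon> \<Sum> 1 / d\<close>. Colouring the integers \<open>d\<close>
  by the cell of a fine grid containing \<open>(d y\<^sub>1, \<dots>, d y\<^sub>k)\<close> modulo 1, some colour class has a
  divergent sum of reciprocals, so \<open>D\<close> may be chosen with \<open>\<epsilon> \<Sum> 1 / d \<ge> 1\<close>. Infinitely many disjoint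
  blocks with summable \<open>\<epsilon>\<close> and the Borel-Cantelli lemma give the result.
\<close>

section \<open>Distance to the nearest integer\<close>

lemma dist_nearest_int_le: "dist_nearest_int t \<le> \<bar>t - of_int a\<bar>"
  unfolding dist_nearest_int_def by (rule round_diff_minimal)

lemma dist_nearest_int_less_iff:
  "dist_nearest_int t < r \<longleftrightarrow> (\<exists>a::int. \<bar>t - of_int a\<bar> < r)"
  using dist_nearest_int_le[of t] unfolding dist_nearest_int_def
  by (meson le_less_trans)

section \<open>Finite colourings of a divergent series\<close>

text \<open>If every colour class gave a summable series, \<open>f\<close> would be a finite sum of
  summable series.\<close>

lemma not_summable_on_colour_class:
  fixes f :: "nat \<Rightarrow> 'a::real_normed_vector" and c :: "nat \<Rightarrow> 'c"
  assumes "finite (range c)" and "\<not> summable f"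
  obtains v where "\<not> summable (\<lambda>n. if c n = v then f n else 0)"
proof -
  have "\<exists>v. \<not> summable (\<lambda>n. if c n = v then f n else 0)"
  proof (rule ccontr)
    assume "\<not> ?thesis"
    then have "summable (\<lambda>n. \<Sum>v\<in>range c. if c n = v then f n else 0)"
      by (intro summable_sum) auto
    moreover have "(\<Sum>v\<in>range c. if c n = v then f n else 0) = f n" for n
      using assms(1) by simp
    ultimately show False using assms(2) by simp
  qed
  then show ?thesis using that by blast
qed

lemma not_summable_nonneg_finite_sum_ge:
  fixes f :: "nat \<Rightarrow> real"
  assumes "\<not> summable f" and "\<And>n. f n \<ge> 0"
  shows "\<exists>n. (\<Sum>i<n. f i) \<ge> S"
proof (rule ccontr)
  assume "\<not> ?thesis"
  then have "\<And>n. (\<Sum>i<n. f i) \<le> S" by (meson less_imp_le not_le)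
  then have "summable f" using assms(2) by (intro summableI_nonneg_bounded[of f S]) auto
  with assms(1) show False by simp
qed

lemma large_reciprocal_sum_with_close_multiples:
  fixes y :: "nat \<Rightarrow> real"
  assumes "\<eta> > 0"
  shows "\<exists>D t. finite D \<and> 0 \<notin> D \<and> (\<Sum>d\<in>D. 1 / real d) \<ge> S \<and>
           (\<forall>i\<le>k. \<forall>d\<in>D. dist_nearest_int (real d * y i - t i) < \<eta>)"
proof -
  obtain K :: nat where K: "K > 0" "1 / real K < \<eta>"
    using assms by (metis inverse_eq_divide real_arch_inverse gr0I)
  \<comment> \<open>The colour is the grid cell of side \<open>1 / K\<close> containing the
    multiples modulo 1. Restricting it to \<open>{..k}\<close> places all colours in a finite
    extensional product.\<close>
  define c where "c n = (\<lambda>i\<in>{..k}. \<lfloor>real K * frac (real n * y i)\<rfloor>)" for n :: nat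
  have "c n \<in> {..k} \<rightarrow>\<^sub>E {0..<int K}" for n
  proof -
    have "0 \<le> real K * frac u" "real K * frac u < real K" for u
      using K(1) frac_lt_1[of u] by auto
    then show ?thesis unfolding c_def by (auto simp: floor_less_iff)
  qed
  then have "finite (range c)"
    by (intro finite_subset[of "range c" "{..k} \<rightarrow>\<^sub>E {0..<int K}"] finite_PiE) auto
  moreover have "\<not> summable (\<lambda>n. 1 / real n)"
    using not_summable_harmonic[where 'a=real] by (simp add: inverse_eq_divide)
  ultimately obtain v where v: "\<not> summable (\<lambda>n. if c n = v then 1 / real n else 0)"
    by (rule not_summable_on_colour_class)
  obtain M where M: "(\<Sum>n<M. if c n = v then 1 / real n else 0) \<ge> S"
    using not_summable_nonneg_finite_sum_ge[OF v, of S] by fastforce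
  \<comment> \<open>Excluding 0 keeps the sum unchanged, since
    \<open>1 / real 0 = 0\<close>.\<close>
  define D where "D = {n. n < M \<and> n \<noteq> 0 \<and> c n = v}"
  have "(\<Sum>n<M. if c n = v then 1 / real n else 0) = (\<Sum>d\<in>D. 1 / real d)"
    by (rule sum.mono_neutral_cong_right) (auto simp: D_def)
  with M have sum: "(\<Sum>d\<in>D. 1 / real d) \<ge> S" by simp
  have "\<exists>t. \<forall>i\<le>k. \<forall>d\<in>D. dist_nearest_int (real d * y i - t i) < \<eta>"
  \<comment> \<open>An empty \<open>D\<close> allows any \<open>t\<close>; otherwise the multiples
    by one fixed \<open>e\<close> in \<open>D\<close> serve as \<open>t\<close>, since all of
    \<open>D\<close> shares the cell of \<open>e\<close>.\<close>
  proof (cases "D = {}")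
    case False
    then obtain e where e: "e \<in> D" by auto
    have "dist_nearest_int (real d * y i - real e * y i) < \<eta>" if "i \<le> k" "d \<in> D" for i d
    proof -
      have "c d i = c e i" using that e by (auto simp: D_def)
      then have "\<lfloor>real K * frac (real d * y i)\<rfloor> = \<lfloor>real K * frac (real e * y i)\<rfloor>"
        using that(1) by (simp add: c_def)
      then have "\<bar>real K * frac (real d * y i) - real K * frac (real e * y i)\<bar> < 1"
        by linarith
      then have "real K * \<bar>frac (real d * y i) - frac (real e * y i)\<bar> < 1"
        using K(1) by (simp add: abs_mult flip: right_diff_distrib)
      then have "\<bar>frac (real d * y i) - frac (real e * y i)\<bar> < 1 / real K"
        using K(1) by (simp add: field_simps)
      then have "\<bar>real d * y i - real e * y i
                  - of_int (\<lfloor>real d * y i\<rfloor> - \<lfloor>real e * y i\<rfloor>)\<bar> < \<eta>"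
        using K(2) unfolding frac_def by (simp add: algebra_simps)
      then show ?thesis unfolding dist_nearest_int_less_iff by blast
    qed
    then show ?thesis by (intro exI[of _ "\<lambda>i. real e * y i"]) auto
  qed auto
  moreover have "finite D" "0 \<notin> D" by (auto simp: D_def)
  ultimately show ?thesis using sum by blast
qed

section \<open>Construction of one block\<close>

text \<open>The parameter \<open>m\<close> lets the block begin after all earlier ones. The lower
  bound 1 is independent of \<epsilon>, so \<epsilon> can shrink from block to block while the sums
  still diverge.\<close>

lemma approximation_block:
  fixes y :: "nat \<Rightarrow> real"
  assumes "\<epsilon> > 0"
  shows "\<exists>N g t. m < N \<and> (\<forall>n. g n \<ge> (0::real)) \<and> (\<Sum>n\<in>{m<..N}. g n) \<ge> 1 \<and>
           (\<forall>i\<le>k. \<forall>n x. dist_nearest_int (real n * x + y i) < g n \<longrightarrow>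
              dist_nearest_int (real N * x + t i) < 2 * \<epsilon>)"
proof -
  obtain D t where D: "finite D" "0 \<notin> D" "(\<Sum>d\<in>D. 1 / real d) \<ge> 1 / \<epsilon>"
    and t: "\<And>i d. i \<le> k \<Longrightarrow> d \<in> D \<Longrightarrow> dist_nearest_int (real d * y i - t i) < \<epsilon>"
    using large_reciprocal_sum_with_close_multiples[OF assms, of "1 / \<epsilon>" k y] by blast
  \<comment> \<open>The factor \<open>Suc m\<close> divides every quotient \<open>N div d\<close>,
    which pushes all of them beyond \<open>m\<close>.\<close>
  define N where "N = Suc m * \<Prod>D"
  \<comment> \<open>For \<open>n = N / d\<close> the value is \<open>\<epsilon> / d\<close>, written
    through \<open>n\<close> so that no \<open>d\<close> has to be chosen.\<close>
  define g where "g n = (if \<exists>d\<in>D. N = d * n then \<epsilon> * real n / real N else 0)" for n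
  have N: "N > m"
  proof -
    have "\<Prod>D \<noteq> 0" using D by simp
    then show ?thesis unfolding N_def by (cases "\<Prod>D") auto
  qed
  have quotient: "N = d * (N div d)" "N div d \<in> {m<..N}" if "d \<in> D" for d
  proof -
    have "d dvd \<Prod>D" using dvd_prodI[OF D(1) that, of "\<lambda>d. d"] by simp
    then obtain q where q: "\<Prod>D = d * q" by (auto elim: dvdE)
    then have Nq: "N = d * (Suc m * q)" by (simp add: N_def algebra_simps)
    have "d > 0" using D(2) that by (metis gr0I)
    then have *: "N div d = Suc m * q" using Nq by simp
    show "N = d * (N div d)" unfolding * by (rule Nq)
    have "q > 0" using Nq N by (cases q) auto
    then show "N div d \<in> {m<..N}"
      unfolding greaterThanAtMost_iff using div_le_dividend[of N d] * by (cases q) auto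
  qed
  \<comment> \<open>The nonzero quotient determines \<open>d\<close> through
    \<open>N = d * (N div d)\<close>, so distinct \<open>d\<close> contribute distinct terms to the
    block sum.\<close>
  have inj: "inj_on (\<lambda>d. N div d) D"
    using quotient N
    by (intro inj_onI) (metis bot_nat_0.not_eq_extremum less_zeroE mult_is_0 mult_right_cancel)
  have g_nonneg: "g n \<ge> 0" for n unfolding g_def using assms by auto
  have "1 \<le> \<epsilon> * (\<Sum>d\<in>D. 1 / real d)"
    using D(3) assms by (simp add: field_simps)
  also have "\<dots> = (\<Sum>d\<in>D. g (N div d))"
    unfolding sum_distrib_left
  proof (rule sum.cong)
    fix d assume d: "d \<in> D"
    have "real N = real d * real (N div d)" using quotient(1)[OF d] by (metis of_nat_mult)
    moreover have "N div d \<noteq> 0" using quotient(2)[OF d] by auto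
    moreover have "g (N div d) = \<epsilon> * real (N div d) / real N"
      using quotient(1)[OF d] d unfolding g_def by auto
    ultimately show "\<epsilon> * (1 / real d) = g (N div d)" by simp
  qed simp
  also have "\<dots> = sum g ((\<lambda>d. N div d) ` D)" by (simp add: sum.reindex[OF inj])
  also have "\<dots> \<le> sum g {m<..N}"
    using quotient(2) g_nonneg by (intro sum_mono2) auto
  finally have sum: "sum g {m<..N} \<ge> 1" .
  have "dist_nearest_int (real N * x + t i) < 2 * \<epsilon>"
    if i: "i \<le> k" and less: "dist_nearest_int (real n * x + y i) < g n" for i n x
  proof -
    \<comment> \<open>Distances are nonnegative, so the strict inequality forces \<open>n\<close> to
      be one of the quotients of \<open>N\<close>.\<close>
    have "g n > 0" using less by (simp add: dist_nearest_int_def)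
    then obtain d where d: "d \<in> D" "N = d * n"
      by (auto simp: g_def split: if_splits)
    have pos: "real d > 0" "real n > 0" using d N by (auto intro!: gr0I)
    have gn: "g n = \<epsilon> / real d" using d pos by (auto simp: g_def)
    obtain a where a: "\<bar>real n * x + y i - of_int a\<bar> < \<epsilon> / real d"
      using less unfolding gn dist_nearest_int_less_iff by auto
    obtain b where b: "\<bar>real d * y i - t i - of_int b\<bar> < \<epsilon>"
      using t[OF i d(1)] unfolding dist_nearest_int_less_iff by auto
    have "real d * \<bar>real n * x + y i - of_int a\<bar> < \<epsilon>"
      using a pos by (simp add: field_simps)
    then have "\<bar>real d * (real n * x + y i - of_int a)\<bar> < \<epsilon>"
      by (simp add: abs_mult)
    moreover have "real d * (real n * x + y i - of_int a)
        = (real N * x + t i - of_int (int d * a - b)) + (real d * y i - t i - of_int b)"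
      by (simp add: d(2) algebra_simps)
    ultimately have "\<bar>real N * x + t i - of_int (int d * a - b)\<bar> < 2 * \<epsilon>"
      using b by linarith
    then show ?thesis unfolding dist_nearest_int_less_iff by blast
  qed
  then show ?thesis using N g_nonneg sum by blast
qed

section \<open>Null sets from the Borel-Cantelli lemma\<close>

lemma infinitely_often_close_null:
  fixes N :: "nat \<Rightarrow> nat" and t \<delta> :: "nat \<Rightarrow> real"
  assumes N: "\<And>k. N k > 0" and \<delta>: "\<And>k. 0 < \<delta> k" "\<And>k. \<delta> k \<le> 1" "summable \<delta>"
  shows "{x. infinite {k. dist_nearest_int (real (N k) * x + t k) < \<delta> k}} \<in> null_sets lebesgue"
    (is "?B \<in> _")
proof -
  \<comment> \<open>Borel-Cantelli needs sets of finite measure, hence the restriction to unit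
    intervals, countably many of which cover the line.\<close>
  have null: "?B \<inter> {of_int m..of_int m + 1} \<in> null_sets lebesgue" for m :: int
  proof -
    \<comment> \<open>These integers include every \<open>a\<close> within \<open>\<delta> k\<close>
      of \<open>N k * x + t k\<close> for some \<open>x\<close> in the unit interval.\<close>
    define J where "J k = {\<lceil>real (N k) * of_int m + t k - \<delta> k\<rceil>
      ..\<lfloor>real (N k) * (of_int m + 1) + t k + \<delta> k\<rfloor>}" for k
    define I where "I k a = {(of_int a - t k - \<delta> k) / real (N k)
      <..<(of_int a - t k + \<delta> k) / real (N k)}" for k and a :: int
    define E where "E k = (\<Union>a\<in>J k. I k a)" for k
    have E_meas: "E k \<in> sets lebesgue" for k
      unfolding E_def I_def J_def by auto
    \<comment> \<open>As \<open>\<delta> k \<le> 1\<close>, there are at most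
      \<open>N k + 3 \<le> 4 * N k\<close> intervals, each of length
      \<open>2 * \<delta> k / N k\<close>.\<close>
    have E_bound: "emeasure lebesgue (E k) \<le> ennreal (8 * \<delta> k)" for k
    proof -
      have pos: "real (N k) > 0" "real (N k) \<ge> 1" using N[of k] by auto
      have I: "emeasure lebesgue (I k a) = ennreal (2 * \<delta> k / real (N k))" for a
      proof -
        have "(of_int a - t k - \<delta> k) / real (N k) \<le> (of_int a - t k + \<delta> k) / real (N k)"
          using pos \<delta>(1)[of k] by (intro divide_right_mono) auto
        then show ?thesis unfolding I_def by (simp flip: diff_divide_distrib)
      qed
      have "emeasure lebesgue (E k) \<le> (\<Sum>a\<in>J k. emeasure lebesgue (I k a))"
        unfolding E_def by (rule emeasure_subadditive_finite) (auto simp: J_def I_def)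
      also have "\<dots> = ennreal (real (card (J k)) * (2 * \<delta> k / real (N k)))"
        unfolding I using pos \<delta>(1)[of k]
        by (subst ennreal_mult) (auto simp: ennreal_of_nat_eq_real_of_nat)
      also have "\<dots> \<le> ennreal (8 * \<delta> k)"
      proof (rule ennreal_leI)
        have "real (card (J k)) \<le> real (N k) + 3"
        proof -
          have "of_int (\<lfloor>real (N k) * (of_int m + 1) + t k + \<delta> k\<rfloor> + 1
              - \<lceil>real (N k) * of_int m + t k - \<delta> k\<rceil>) \<le> real (N k) + 3"
            using \<delta>(2)[of k] le_of_int_ceiling[of "real (N k) * of_int m + t k - \<delta> k"]
              of_int_floor_le[of "real (N k) * (of_int m + 1) + t k + \<delta> k"]
              distrib_left[of "real (N k)" "of_int m" 1]
            unfolding of_int_add of_int_diff of_int_1 mult_1_right by linarith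
          then show ?thesis unfolding J_def by simp
        qed
        then have "real (card (J k)) \<le> 4 * real (N k)" using pos by linarith
        then have "real (card (J k)) * (2 * \<delta> k / real (N k))
            \<le> 4 * real (N k) * (2 * \<delta> k / real (N k))"
          using pos \<delta>(1)[of k] by (intro mult_right_mono) auto
        then show "real (card (J k)) * (2 * \<delta> k / real (N k)) \<le> 8 * \<delta> k"
          using pos by simp
      qed
      finally show ?thesis .
    qed
    have E_fin: "emeasure lebesgue (E k) < \<infinity>" for k
      using E_bound[of k] by (simp add: le_less_trans)
    have "summable (\<lambda>k. measure lebesgue (E k))"
    proof (rule summable_comparison_test')
      show "summable (\<lambda>k. 8 * \<delta> k)" using \<delta>(3) by (rule summable_mult)
      show "norm (measure lebesgue (E k)) \<le> 8 * \<delta> k" for k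
        using E_bound[of k] \<delta>(1)[of k] by (simp add: measure_def enn2real_leI)
    qed
    then have limsup: "limsup E \<in> null_sets lebesgue"
      using E_meas E_fin by (intro borel_cantelli_limsup1) auto
    have "?B \<inter> {of_int m..of_int m + 1} \<subseteq> limsup E"
    proof
      fix x :: real assume x: "x \<in> ?B \<inter> {of_int m..of_int m + 1}"
      have "x \<in> E k" if close: "dist_nearest_int (real (N k) * x + t k) < \<delta> k" for k
      proof -
        have pos: "real (N k) > 0" using N[of k] by auto
        obtain a where a: "\<bar>real (N k) * x + t k - of_int a\<bar> < \<delta> k"
          using close unfolding dist_nearest_int_less_iff by auto
        have "real (N k) * of_int m \<le> real (N k) * x"
          "real (N k) * x \<le> real (N k) * (of_int m + 1)"
          using x pos by auto
        then have "a \<in> J k" using a unfolding J_def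
          by (auto simp: ceiling_le_iff le_floor_iff abs_less_iff)
        moreover have "x \<in> I k a"
          using a pos unfolding I_def by (auto simp: field_simps abs_less_iff)
        ultimately show ?thesis unfolding E_def by blast
      qed
      then have "{k. dist_nearest_int (real (N k) * x + t k) < \<delta> k} \<subseteq> {k. x \<in> E k}" by blast
      then have "infinite {k. x \<in> E k}" using x infinite_super by blast
      then have "\<forall>n. \<exists>k\<ge>n. x \<in> E k" by (simp add: infinite_nat_iff_unbounded_le)
      then show "x \<in> limsup E" by (auto simp: limsup_INF_SUP)
    qed
    \<comment> \<open>Lebesgue measure is complete, so a subset of a null set is null without a
      separate measurability proof.\<close>
    then show ?thesis using limsup by (meson null_sets_completion_subset)
  qed
  have "?B \<subseteq> (\<Union>m::int. ?B \<inter> {of_int m..of_int m + 1})"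
  proof
    fix x assume "x \<in> ?B"
    moreover have "x \<in> {of_int \<lfloor>x\<rfloor>..of_int \<lfloor>x\<rfloor> + 1}"
      using floor_correct[of x] by auto
    ultimately show "x \<in> (\<Union>m::int. ?B \<inter> {of_int m..of_int m + 1})" by blast
  qed
  moreover have "(\<Union>m::int. ?B \<inter> {of_int m..of_int m + 1}) \<in> null_sets lebesgue"
    by (rule null_sets_UN) (rule null)
  ultimately show ?thesis by (meson null_sets_completion_subset)
qed

section \<open>Concatenation of the blocks\<close>

lemma strict_mono_interval_index:
  fixes M :: "nat \<Rightarrow> nat"
  assumes "strict_mono M" and "M k < n" and "n \<le> M (Suc k)"
  shows "(LEAST j. n \<le> M (Suc j)) = k"
proof (rule Least_equality)
  fix j assume "n \<le> M (Suc j)"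
  then have "M k < M (Suc j)" using assms(2) by simp
  then show "k \<le> j" using assms(1) by (simp add: strict_mono_less)
qed (rule assms(3))

theorem theorem1p1:
  fixes y :: "nat \<Rightarrow> real"
  shows "\<exists>\<psi> :: nat \<Rightarrow> real.
           (\<forall>n\<ge>1. \<psi> n \<ge> 0) \<and>
           \<not> summable (\<lambda>n. \<psi> (Suc n)) \<and>
           (\<forall>z \<in> y ` {1..}.
              {x :: real. infinite {n :: nat. n \<ge> 1 \<and> dist_nearest_int (of_nat n * x + z) < \<psi> n}}
                \<in> null_sets lebesgue)"
proof -
  \<comment> \<open>With \<open>\<epsilon> = (1/2) ^ Suc k\<close> the closeness bound is
    \<open>(1/2) ^ k\<close>, which is summable and at most 1. Stage \<open>k\<close> treats
    \<open>y 0\<close> to \<open>y k\<close>, so each \<open>y i\<close> is treated from stage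
    \<open>i\<close> on.\<close>
  have "\<forall>k m. \<exists>N g t. m < N \<and> (\<forall>n. g n \<ge> (0::real)) \<and> (\<Sum>n\<in>{m<..N}. g n) \<ge> 1 \<and>
      (\<forall>i\<le>k. \<forall>n x. dist_nearest_int (real n * x + y i) < g n \<longrightarrow>
         dist_nearest_int (real N * x + t i) < 2 * (1/2) ^ Suc k)"
    by (intro allI approximation_block) simp
  then obtain N g t where
    N: "\<And>k m. m < N k m" and
    g: "\<And>k m n. g k m n \<ge> (0::real)" "\<And>k m. (\<Sum>n\<in>{m<..N k m}. g k m n) \<ge> 1" and
    t: "\<And>k m i n x. i \<le> k \<Longrightarrow> dist_nearest_int (real n * x + y i) < g k m n \<Longrightarrow>
         dist_nearest_int (real (N k m) * x + t k m i) < 2 * (1/2) ^ Suc k"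
    by metis
  \<comment> \<open>Each block starts where the previous one ends: block \<open>k\<close> is the
    interval from \<open>M k\<close> (excluded) to \<open>M (Suc k)\<close>.\<close>
  define M where "M = rec_nat 0 N"
  have M_Suc: "M (Suc k) = N k (M k)" and M_0: "M 0 = 0" for k
    by (simp_all add: M_def)
  have mono: "strict_mono M"
    using N by (simp add: strict_mono_Suc_iff M_Suc)
  define index where "index n = (LEAST j. n \<le> M (Suc j))" for n
  define \<psi> where "\<psi> n = g (index n) (M (index n)) n" for n
  have index_le: "n \<le> M (Suc (index n))" for n
    unfolding index_def
    by (rule LeastI[of _ n]) (meson le_trans strict_mono_imp_increasing mono lessI less_imp_le)
  have psi_nonneg: "\<psi> n \<ge> 0" for n by (simp add: \<psi>_def g(1))
  have partial: "real k \<le> (\<Sum>n\<in>{0<..M k}. \<psi> n)" for k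
  proof (induction k)
    case (Suc k)
    have less: "M k < M (Suc k)" using mono by (simp add: strict_mono_less)
    have "(\<Sum>n\<in>{M k<..M (Suc k)}. \<psi> n) = (\<Sum>n\<in>{M k<..M (Suc k)}. g k (M k) n)"
      by (rule sum.cong) (auto simp: \<psi>_def index_def strict_mono_interval_index[OF mono])
    then have "(\<Sum>n\<in>{M k<..M (Suc k)}. \<psi> n) \<ge> 1" using g(2) by (simp add: M_Suc)
    moreover have "{0<..M (Suc k)} = {0<..M k} \<union> {M k<..M (Suc k)}" using less by auto
    then have "(\<Sum>n\<in>{0<..M (Suc k)}. \<psi> n)
        = (\<Sum>n\<in>{0<..M k}. \<psi> n) + (\<Sum>n\<in>{M k<..M (Suc k)}. \<psi> n)"
      by (simp add: sum.union_disjoint)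
    ultimately show ?case using Suc.IH by simp
  qed (simp add: M_0)
  have "\<not> summable (\<lambda>n. \<psi> (Suc n))"
  proof
    assume s: "summable (\<lambda>n. \<psi> (Suc n))"
    obtain k :: nat where k: "real k > (\<Sum>n. \<psi> (Suc n))" using reals_Archimedean2 by blast
    have "real k \<le> (\<Sum>n\<in>{0<..M k}. \<psi> n)" by (rule partial)
    also have "\<dots> = (\<Sum>n<M k. \<psi> (Suc n))"
      by (rule sum.reindex_bij_witness[of _ Suc "\<lambda>n. n - 1"]) auto
    also have "\<dots> \<le> (\<Sum>n. \<psi> (Suc n))"
      using s psi_nonneg by (intro sum_le_suminf) auto
    finally show False using k by simp
  qed
  moreover have "{x. infinite {n. n \<ge> 1 \<and> dist_nearest_int (real n * x + y i) < \<psi> n}}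
      \<in> null_sets lebesgue" for i
  proof -
    let ?close = "\<lambda>x. {k. dist_nearest_int (real (M (Suc k)) * x + t k (M k) i) < (1/2) ^ k}"
    have "{x. infinite (?close x)} \<in> null_sets lebesgue"
    proof (rule infinitely_often_close_null)
      show "M (Suc k) > 0" for k using N[of "M k" k] by (simp add: M_Suc)
      show "((1/2) ^ k :: real) \<le> 1" for k by (simp add: power_le_one)
    qed (auto intro: summable_geometric)
    moreover have "infinite (?close x)"
      if inf: "infinite {n. n \<ge> 1 \<and> dist_nearest_int (real n * x + y i) < \<psi> n}"
        (is "infinite ?S") for x
    proof
      assume fin: "finite (?close x)"
      \<comment> \<open>Blocks before \<open>i\<close> give no control of \<open>y i\<close>, but
        there are finitely many, and each block contains finitely many \<open>n\<close>.\<close>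
      have "index n \<in> ?close x \<union> {..<i}" if "n \<in> ?S" for n
        using that t[of i "index n" n x "M (index n)"]
        by (auto simp: \<psi>_def M_Suc not_less)
      then have "?S \<subseteq> (\<Union>k\<in>?close x \<union> {..<i}. {..M (Suc k)})"
        using index_le by blast
      moreover have "finite (\<Union>k\<in>?close x \<union> {..<i}. {..M (Suc k)})" using fin by auto
      ultimately show False using inf finite_subset by blast
    qed
    then have "{x. infinite {n. n \<ge> 1 \<and> dist_nearest_int (real n * x + y i) < \<psi> n}}
        \<subseteq> {x. infinite (?close x)}" by blast
    ultimately show ?thesis by (meson null_sets_completion_subset)
  qed
  ultimately show ?thesis using psi_nonneg by (intro exI[of _ \<psi>]) auto
qed

end
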